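(* Let $K$ be a finite simplicial complex with exactly $n$ (distinct) facets $F_1,\dots,F_n$. Then $K$ is a clique complex if and only if for every $3$-element subset $\{i,j,k\}\subseteq\{1,\dots,n\}$ the set $$F_{ijk}=(F_i\cap F_j)\cup(F_i\cap F_k)\cup(F_j\cap F_k)$$ is a face of $K$.
   Context: A (finite abstract) simplicial complex is a collection of subsets (faces) of a finite base set $V$ closed under taking subsets; the empty set counts as a face, and the base set is the union of the facets (so every vertex is a face). Facets are the inclusion-maximal faces. A clique complex is a simplicial complex whose faces are exactly the cliques (including the empty set and single vertices) of some finite simple graph on the vertex set $V$; equivalently (flag complex), every $A\subseteq V$ all of whose $2$-element subsets are faces is itself a face. *)

theory Defs
  imports Main "HOL-Library.Ramsey"
begin

(* V is the base set. Since V is the union of the facets, every vertex is a face. *)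

definition facets :: "'a set set \<Rightarrow> 'a set set" where
  "facets K = {F \<in> K. \<forall>G\<in>K. F \<subseteq> G \<longrightarrow> F = G}"

definition simplicial_complex :: "'a set \<Rightarrow> 'a set set \<Rightarrow> bool" where
  "simplicial_complex V K \<longleftrightarrow>
     finite V \<and> K \<subseteq> Pow V \<and> {} \<in> K \<and>
     (\<forall>A\<in>K. \<forall>B. B \<subseteq> A \<longrightarrow> B \<in> K) \<and> \<Union>(facets K) = V"

(* A simple graph is a vertex set V with a set E of 2-element subsets of V. *)

definition simple_graph :: "'a set \<Rightarrow> 'a set set \<Rightarrow> bool" where
  "simple_graph V E \<longleftrightarrow> finite V \<and> E \<subseteq> [V]\<^bsup>2\<^esup>"

(* The library predicate clique A E does not require A to lie in the vertex set. *)

definition clique_complex :: "'a set \<Rightarrow> 'a set set \<Rightarrow> bool" where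
  "clique_complex V K \<longleftrightarrow>
     simplicial_complex V K \<and> (\<exists>E. simple_graph V E \<and> K = {A. A \<subseteq> V \<and> clique A E})"

end

theory Submission
  imports Defs
begin

text \<open>
  The set in the theorem is a majority set: it consists of the points that lie in at least two of
  three given facets. Two such points always share one of the three facets, since two
  two-element subsets of a three-element set meet. So all pairs inside a majority set are faces, and
  a complex that is determined by its edges must contain the majority set itself.

  For the converse, take a set \<open>A\<close> of vertices all of whose pairs are faces and induct on its size.
  Delete three different points from \<open>A\<close>, one at a time. The three resulting sets are faces by
  induction, and every point of \<open>A\<close> survives in at least two of them. Hence \<open>A\<close> lies in the majority
  set of any three facets that contain them, and it is a face if the three facets are distinct. If two
  of the facets coincide, that facet already contains all of \<open>A\<close>. The argument is carried out for
  facets as sets in \<open>clique_complex_iff_majorities_are_faces\<close>; the enumeration of the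
  facets enters only in the final translation.
\<close>

lemma simplicial_complex_subset_face:
  assumes "simplicial_complex V K" "A \<in> K" "B \<subseteq> A"
  shows "B \<in> K"
  using assms by (simp add: simplicial_complex_def)

lemma face_subset_vertices:
  assumes "simplicial_complex V K" "A \<in> K"
  shows "A \<subseteq> V"
  using assms by (auto simp: simplicial_complex_def)

lemma face_in_facet:
  assumes K: "simplicial_complex V K" and A: "A \<in> K"
  obtains F where "F \<in> facets K" "A \<subseteq> F"
proof -
  have "finite K"
    using K unfolding simplicial_complex_def by (meson finite_Pow_iff finite_subset)
  from finite_has_maximal2[OF this A] obtain M
    where "M \<in> K" "A \<subseteq> M" "\<forall>B\<in>K. M \<subseteq> B \<longrightarrow> M = B"
    by blast
  then show ?thesis
    using that unfolding facets_def by blast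
qed

lemma singleton_face:
  assumes K: "simplicial_complex V K" and v: "v \<in> V"
  shows "{v} \<in> K"
proof -
  have "V = \<Union>(facets K)"
    using K by (simp add: simplicial_complex_def)
  with v obtain F where "F \<in> facets K" "v \<in> F"
    by auto
  then show ?thesis
    using simplicial_complex_subset_face[OF K, of F "{v}"] by (simp add: facets_def)
qed

text \<open>
  The flag condition. The graph in the definition of a clique complex can only be the 1-skeleton,
  because its edges are exactly its two-element cliques. The pairs below may be
  degenerate, as \<open>{v, v}\<close> is a face anyway; this spares every use a case distinction.
\<close>

lemma clique_complex_iff_flag:
  assumes K: "simplicial_complex V K"
  shows "clique_complex V K \<longleftrightarrow>
    (\<forall>A. A \<subseteq> V \<and> (\<forall>v\<in>A. \<forall>w\<in>A. {v, w} \<in> K) \<longrightarrow> A \<in> K)"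
    (is "_ \<longleftrightarrow> ?flag")
proof
  assume "clique_complex V K"
  then obtain E where E: "K = {A. A \<subseteq> V \<and> clique A E}"
    unfolding clique_complex_def by blast
  show ?flag
    unfolding E clique_def by blast
next
  assume flag: ?flag
  define E where "E = K \<inter> [V]\<^bsup>2\<^esup>"
  have "simple_graph V E"
    using K by (simp add: simple_graph_def simplicial_complex_def E_def)
  have "A \<in> K \<longleftrightarrow> A \<subseteq> V \<and> clique A E" for A
  proof
    assume A: "A \<in> K"
    then have "A \<subseteq> V"
      by (rule face_subset_vertices[OF K])
    moreover have "{v, w} \<in> E" if "v \<in> A" "w \<in> A" "v \<noteq> w" for v w
      using simplicial_complex_subset_face[OF K A, of "{v, w}"] \<open>A \<subseteq> V\<close> that
      by (auto simp: E_def nsets_def)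
    ultimately show "A \<subseteq> V \<and> clique A E"
      unfolding clique_def by blast
  next
    assume A: "A \<subseteq> V \<and> clique A E"
    have "{v, w} \<in> K" if "v \<in> A" "w \<in> A" for v w
    proof (cases "v = w")
      case True
      then show ?thesis
        using singleton_face[OF K] A that by auto
    next
      case False
      then show ?thesis
        using A that unfolding clique_def E_def by blast
    qed
    then show "A \<in> K"
      using flag A by blast
  qed
  then have "K = {A. A \<subseteq> V \<and> clique A E}"
    by (simp add: set_eq_iff)
  with \<open>simple_graph V E\<close> show "clique_complex V K"
    using K unfolding clique_complex_def by metis
qed

text \<open>
  The combinatorial core of the converse: a point of \<open>A\<close> equals at most one of \<open>a\<close>, \<open>b\<close>, \<open>c\<close>, so it
  survives at least two of the three deletions.
\<close>

lemma subset_majority_of_deletions: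
  assumes "a \<noteq> b" "a \<noteq> c" "b \<noteq> c"
    and "A - {a} \<subseteq> F" "A - {b} \<subseteq> G" "A - {c} \<subseteq> H"
  shows "A \<subseteq> (F \<inter> G) \<union> (F \<inter> H) \<union> (G \<inter> H)"
  using assms by blast

theorem clique_complex_iff_majorities_are_faces:
  assumes K: "simplicial_complex V K"
  shows "clique_complex V K \<longleftrightarrow>
    (\<forall>F\<in>facets K. \<forall>G\<in>facets K. \<forall>H\<in>facets K. F \<noteq> G \<and> F \<noteq> H \<and> G \<noteq> H \<longrightarrow>
       (F \<inter> G) \<union> (F \<inter> H) \<union> (G \<inter> H) \<in> K)"
    (is "_ \<longleftrightarrow> ?majorities")
proof
  assume "clique_complex V K"
  then have flag: "A \<in> K" if "A \<subseteq> V" "\<And>v w. v \<in> A \<Longrightarrow> w \<in> A \<Longrightarrow> {v, w} \<in> K" for A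
    using that clique_complex_iff_flag[OF K] by blast
  have "(F \<inter> G) \<union> (F \<inter> H) \<union> (G \<inter> H) \<in> K" (is "?M \<in> K")
    if "F \<in> facets K" "G \<in> facets K" "H \<in> facets K" for F G H
  proof (rule flag)
    have faces: "F \<in> K" "G \<in> K" "H \<in> K"
      using that by (auto simp: facets_def)
    then show "?M \<subseteq> V"
      using face_subset_vertices[OF K] by blast
    show "{v, w} \<in> K" if "v \<in> ?M" "w \<in> ?M" for v w
    proof -
      have "{v, w} \<subseteq> F \<or> {v, w} \<subseteq> G \<or> {v, w} \<subseteq> H"
        using that by blast
      then show ?thesis
        using faces simplicial_complex_subset_face[OF K] by blast
    qed
  qed
  then show ?majorities
    by blast
next
  assume majorities: ?majorities
  have "A \<in> K" if "A \<subseteq> V" "\<And>v w. v \<in> A \<Longrightarrow> w \<in> A \<Longrightarrow> {v, w} \<in> K" for A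
  proof -
    have "finite A"
      using K that(1) unfolding simplicial_complex_def by (meson finite_subset)
    then show ?thesis
      using that
    proof (induction A rule: finite_psubset_induct)
      case (psubset A)
      show ?case
      proof (cases "\<exists>a\<in>A. \<exists>b\<in>A. \<exists>c\<in>A. a \<noteq> b \<and> a \<noteq> c \<and> b \<noteq> c")
        case False
        show ?thesis
        proof (cases "\<exists>v\<in>A. \<exists>w\<in>A. A = {v, w}")
          case True
          then show ?thesis
            using psubset.prems(2) by metis
        next
          case no_pair: False
          have "A = {}"
          proof (rule ccontr)
            assume "A \<noteq> {}"
            then obtain v where v: "v \<in> A"
              by blast
            then obtain w where w: "w \<in> A" "w \<noteq> v"
              using no_pair by fast
            with v obtain x where "x \<in> A" "x \<noteq> v" "x \<noteq> w"
              using no_pair by fast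
            with v w False show "False"
              by metis
          qed
          then show ?thesis
            using K unfolding simplicial_complex_def by simp
        qed
      next
        case True
        then obtain a b c where abc: "a \<in> A" "b \<in> A" "c \<in> A" "a \<noteq> b" "a \<noteq> c" "b \<noteq> c"
          by blast
        have deletion: "A - {x} \<in> K" if "x \<in> A" for x
          by (rule psubset.IH) (use that psubset.prems in auto)
        obtain F where F: "F \<in> facets K" "A - {a} \<subseteq> F"
          using face_in_facet[OF K deletion] abc by metis
        obtain G where G: "G \<in> facets K" "A - {b} \<subseteq> G"
          using face_in_facet[OF K deletion] abc by metis
        obtain H where H: "H \<in> facets K" "A - {c} \<subseteq> H"
          using face_in_facet[OF K deletion] abc by metis
        let ?M = "(F \<inter> G) \<union> (F \<inter> H) \<union> (G \<inter> H)"
        have "A \<subseteq> ?M"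
          using abc(4-6) F(2) G(2) H(2) by (rule subset_majority_of_deletions)
        moreover have "?M \<in> K"
        proof (cases "F \<noteq> G \<and> F \<noteq> H \<and> G \<noteq> H")
          case True
          then show ?thesis
            using majorities F G H by blast
        next
          (* The majority set of three sets, two of which agree, is the repeated set. *)
          case False
          then consider "F = G" | "F = H" | "G = H"
            by metis
          then have "?M = F \<or> ?M = G"
            by cases auto
          moreover have "F \<in> K" "G \<in> K"
            using F G by (auto simp: facets_def)
          ultimately show ?thesis
            by metis
        qed
        ultimately show ?thesis
          using simplicial_complex_subset_face[OF K] by blast
      qed
    qed
  qed
  then show "clique_complex V K"
    unfolding clique_complex_iff_flag[OF K] by blast
qed

theorem theorem3p1:
  fixes V :: "'a set" and K :: "'a set set" and n :: nat and F :: "nat \<Rightarrow> 'a set"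
  assumes "simplicial_complex V K"
    and "bij_betw F {1..n} (facets K)"
  shows "clique_complex V K \<longleftrightarrow>
    (\<forall>i\<in>{1..n}. \<forall>j\<in>{1..n}. \<forall>k\<in>{1..n}. i \<noteq> j \<and> i \<noteq> k \<and> j \<noteq> k \<longrightarrow>
       (F i \<inter> F j) \<union> (F i \<inter> F k) \<union> (F j \<inter> F k) \<in> K)"
proof -
  have facets: "facets K = F ` {1..n}" and inj: "inj_on F {1..n}"
    using assms(2) by (auto simp: bij_betw_def)
  have distinct: "F i \<noteq> F j \<longleftrightarrow> i \<noteq> j" if "i \<in> {1..n}" "j \<in> {1..n}" for i j
    using inj_on_eq_iff[OF inj that] by simp
  show ?thesis
    unfolding clique_complex_iff_majorities_are_faces[OF assms(1)] facets Set.ball_simps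
    by (intro ball_cong refl) (simp only: distinct)
qed

end
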